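(* Let $T\subseteq 2^{<\omega}$ be a nonempty uniformly perfect tree. Then its body $[T]$ does not belong to $\mathfrak{P}_2$.
   Context: $2^{<\omega}=\bigcup_{n<\omega}2^n$ is the set of finite $0$-$1$ sequences and $2^\omega$ is the Cantor space; $[\omega]^\omega$ is the family of infinite subsets of $\omega$. A set $T\subseteq 2^{<\omega}$ is a tree if for every $\tau\in T$ and $n\in\omega$ we have $\tau\restriction n\in T$. The body of $T$ is $[T]=\{x\in 2^\omega:(\forall n\in\omega)\ x\restriction n\in T\}$. Let $\mathrm{split}(T)=\{\tau\in T:\tau^\frown 0\in T\text{ and }\tau^\frown 1\in T\}$. $T$ is perfect if for every $\tau\in T$ there is $\sigma\supseteq\tau$ with $\sigma\in\mathrm{split}(T)$. $T$ is uniformly perfect if it is perfect and for every $n\in\omega$ either $2^n\cap T\subseteq\mathrm{split}(T)$ or $2^n\cap\mathrm{split}(T)=\emptyset$. For $X\subseteq 2^\omega$ and $S\in[\omega]^\omega$, $X\restriction S=\{x\restriction S:x\in X\}\subseteq 2^S$. Finally, $\mathfrak{P}_2=\{X\subseteq 2^\omega:(\forall S\in[\omega]^\omega)\ X\restriction S\neq 2^S\}$. *)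

theory Defs
  imports Main "HOL-Library.FuncSet" "HOL-Library.Sublist"
begin

text \<open>The digits 0 and 1 are \<open>False\<close> and \<open>True\<close>. Elements of $2^{<\omega}$ are thus
  boolean lists, and elements of the Cantor space $2^\omega$ are functions of type
  \<open>nat \<Rightarrow> bool\<close>.\<close>

definition is_tree :: "bool list set \<Rightarrow> bool" where
  "is_tree T \<longleftrightarrow> (\<forall>\<tau>\<in>T. \<forall>n. take n \<tau> \<in> T)"

definition initial_seg :: "(nat \<Rightarrow> bool) \<Rightarrow> nat \<Rightarrow> bool list" where
  "initial_seg x n = map x [0..<n]"

definition body :: "bool list set \<Rightarrow> (nat \<Rightarrow> bool) set" where
  "body T = {x. \<forall>n. initial_seg x n \<in> T}"

definition split_nodes :: "bool list set \<Rightarrow> bool list set" where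
  "split_nodes T = {\<tau> \<in> T. \<tau> @ [False] \<in> T \<and> \<tau> @ [True] \<in> T}"

definition perfect :: "bool list set \<Rightarrow> bool" where
  "perfect T \<longleftrightarrow> (\<forall>\<tau>\<in>T. \<exists>\<sigma>. prefix \<tau> \<sigma> \<and> \<sigma> \<in> split_nodes T)"

definition level :: "nat \<Rightarrow> bool list set" where
  "level n = {\<tau>. length \<tau> = n}"

definition uniformly_perfect :: "bool list set \<Rightarrow> bool" where
  "uniformly_perfect T \<longleftrightarrow> perfect T \<and>
     (\<forall>n. level n \<inter> T \<subseteq> split_nodes T \<or> level n \<inter> split_nodes T = {})"

text \<open>For a set \<open>S\<close> of indices, $2^S$ is the extensional function space
  \<open>S \<rightarrow>\<^sub>E UNIV\<close>, whose elements take a fixed dummy value outside \<open>S\<close>; \<open>restrict x S\<close>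
  uses the same dummy value.\<close>

definition restrict_family :: "(nat \<Rightarrow> bool) set \<Rightarrow> nat set \<Rightarrow> (nat \<Rightarrow> bool) set" where
  "restrict_family X S = (\<lambda>x. restrict x S) ` X"

definition P2 :: "(nat \<Rightarrow> bool) set set" where
  "P2 = {X. \<forall>S. infinite S \<longrightarrow> restrict_family X S \<noteq> (S \<rightarrow>\<^sub>E UNIV)}"

end

theory Submission
  imports Defs
begin

text \<open>Let \<open>S\<close> be the set of levels all of whose nodes split. A perfect tree has splitting nodes at
  arbitrarily high levels, and uniformity puts the level of every splitting node into \<open>S\<close>; so \<open>S\<close>
  is infinite. The restrictions of the branches to \<open>S\<close> exhaust $2^S$: given \<open>f\<close> on \<open>S\<close>, climb the
  tree from the root, choosing the digit \<open>f n\<close> at each level \<open>n \<in> S\<close>, where both digits stay in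
  the tree, and any digit that stays in the tree at the other levels. The branch so built is a
  member of the body that agrees with \<open>f\<close> on \<open>S\<close>.\<close>

text \<open>The nodes met when climbing from the root according to the rule \<open>c\<close>, which picks the next
  digit from the node already reached.\<close>
primrec follow :: "(bool list \<Rightarrow> bool) \<Rightarrow> nat \<Rightarrow> bool list" where
  "follow c 0 = []"
| "follow c (Suc n) = follow c n @ [c (follow c n)]"

lemma initial_seg_follow: "initial_seg (\<lambda>n. c (follow c n)) n = follow c n"
  by (induction n) (simp_all add: initial_seg_def)

lemma length_initial_seg [simp]: "length (initial_seg x n) = n"
  by (simp add: initial_seg_def)

text \<open>This separates the construction of a branch from the choice of its digits: a rule for the next
  digit that never leaves the tree can be iterated forever.\<close>
lemma body_follows_rule:
  assumes "[] \<in> T" and step: "\<And>\<tau>. \<tau> \<in> T \<Longrightarrow> \<tau> @ [c \<tau>] \<in> T"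
  obtains x where "x \<in> body T" and "\<And>n. x n = c (initial_seg x n)"
proof
  let ?x = "\<lambda>n. c (follow c n)"
  have "follow c n \<in> T" for n
    by (induction n) (simp_all add: assms)
  then show "?x \<in> body T"
    by (simp add: body_def initial_seg_follow)
  show "?x n = c (initial_seg ?x n)" for n
    by (simp add: initial_seg_follow)
qed

lemma tree_prefix_closed:
  assumes "is_tree T" and "\<sigma> \<in> T" and "prefix \<tau> \<sigma>"
  shows "\<tau> \<in> T"
proof -
  have "\<tau> = take (length \<tau>) \<sigma>"
    using \<open>prefix \<tau> \<sigma>\<close> by (auto simp: prefix_def)
  then show ?thesis
    using assms by (metis is_tree_def)
qed

lemma tree_root:
  assumes "is_tree T" and "T \<noteq> {}"
  shows "[] \<in> T"
  using assms tree_prefix_closed[OF assms(1) _ Nil_prefix] by blast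

text \<open>A perfect tree has no leaves: above a node there is a splitting node, and if this is the node
  itself, then one of its own successors serves.\<close>
lemma perfect_tree_successor:
  assumes "is_tree T" and "perfect T" and "\<tau> \<in> T"
  shows "\<exists>b. \<tau> @ [b] \<in> T"
proof -
  obtain \<sigma> where \<sigma>: "prefix \<tau> \<sigma>" "\<sigma> \<in> split_nodes T"
    using assms by (auto simp: perfect_def)
  then obtain \<rho> where \<rho>: "\<sigma> = \<tau> @ \<rho>"
    by (auto simp: prefix_def)
  have *: "\<tau> @ (\<rho> @ [True]) \<in> T"
    using \<sigma>(2) \<rho> by (simp add: split_nodes_def)
  obtain b \<rho>' where "\<rho> @ [True] = b # \<rho>'"
    by (cases "\<rho> @ [True]") auto
  then have "prefix (\<tau> @ [b]) (\<tau> @ (\<rho> @ [True]))"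
    by simp
  then show ?thesis
    using tree_prefix_closed[OF assms(1) *] by blast
qed

definition splitting_levels :: "bool list set \<Rightarrow> nat set" where
  "splitting_levels T = {n. level n \<inter> T \<subseteq> split_nodes T}"

lemma splitting_levelD:
  assumes "length \<tau> \<in> splitting_levels T" and "\<tau> \<in> T"
  shows "\<tau> @ [b] \<in> T"
proof -
  have "\<tau> \<in> split_nodes T"
    using assms by (auto simp: splitting_levels_def level_def)
  then show ?thesis
    by (cases b) (simp_all add: split_nodes_def)
qed

text \<open>The digits of a branch at splitting levels are independent of each other, since a prescribed
  digit at such a level leads into the tree from whatever node has been reached.\<close>
lemma body_prescribed_on_splitting_levels:
  assumes "is_tree T" and "T \<noteq> {}" and "perfect T"
  obtains x where "x \<in> body T" and "\<And>n. n \<in> splitting_levels T \<Longrightarrow> x n = f n"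
proof -
  let ?S = "splitting_levels T"
  define c where "c \<tau> = (if length \<tau> \<in> ?S then f (length \<tau>) else SOME b. \<tau> @ [b] \<in> T)" for \<tau>
  have "\<tau> @ [c \<tau>] \<in> T" if "\<tau> \<in> T" for \<tau>
  proof (cases "length \<tau> \<in> ?S")
    case True
    then show ?thesis
      using that by (rule splitting_levelD)
  next
    case False
    then show ?thesis
      using someI_ex[OF perfect_tree_successor[OF assms(1,3) that]] by (simp add: c_def)
  qed
  then obtain x where "x \<in> body T" and "\<And>n. x n = c (initial_seg x n)"
    using body_follows_rule[OF tree_root[OF assms(1,2)]] by blast
  then show thesis
    using that by (simp add: c_def)
qed

text \<open>Any branch reaches level \<open>n\<close>, and a splitting node above its node there has level at
  least \<open>n\<close>; by uniformity, one splitting node makes its whole level split.\<close>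
lemma infinite_splitting_levels:
  assumes "is_tree T" and "T \<noteq> {}" and "uniformly_perfect T"
  shows "infinite (splitting_levels T)"
proof -
  have perfect: "perfect T"
    using assms(3) by (simp add: uniformly_perfect_def)
  have "\<exists>m\<ge>n. m \<in> splitting_levels T" for n
  proof -
    obtain x where "x \<in> body T"
      using body_prescribed_on_splitting_levels[OF assms(1,2) perfect] by blast
    then have "initial_seg x n \<in> T"
      by (simp add: body_def)
    then obtain \<sigma> where \<sigma>: "prefix (initial_seg x n) \<sigma>" "\<sigma> \<in> split_nodes T"
      using perfect by (auto simp: perfect_def)
    have "n \<le> length \<sigma>"
      using prefix_length_le[OF \<sigma>(1)] by simp
    moreover have "level (length \<sigma>) \<inter> split_nodes T \<noteq> {}"
      using \<sigma>(2) by (auto simp: level_def)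
    then have "length \<sigma> \<in> splitting_levels T"
      using assms(3) by (auto simp: uniformly_perfect_def splitting_levels_def)
    ultimately show ?thesis
      by blast
  qed
  then show ?thesis
    by (meson finite_nat_set_iff_bounded not_less)
qed

theorem theorem2p2:
  fixes T :: "bool list set"
  assumes "is_tree T"
    and "T \<noteq> {}"
    and "uniformly_perfect T"
  shows "body T \<notin> P2"
proof -
  let ?S = "splitting_levels T"
  have perfect: "perfect T"
    using assms(3) by (simp add: uniformly_perfect_def)
  have "f \<in> restrict_family (body T) ?S" if f: "f \<in> ?S \<rightarrow>\<^sub>E UNIV" for f
  proof -
    obtain x where x: "x \<in> body T" "\<And>n. n \<in> ?S \<Longrightarrow> x n = f n"
      using body_prescribed_on_splitting_levels[OF assms(1,2) perfect] by blast
    have "f = restrict x ?S"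
      using x(2) PiE_arb[OF f] by (auto simp: restrict_def)
    then show ?thesis
      using x(1) by (auto simp: restrict_family_def)
  qed
  moreover have "restrict_family (body T) ?S \<subseteq> ?S \<rightarrow>\<^sub>E UNIV"
    by (auto simp: restrict_family_def)
  ultimately have "restrict_family (body T) ?S = (?S \<rightarrow>\<^sub>E UNIV)"
    by blast
  then show ?thesis
    using infinite_splitting_levels[OF assms] by (auto simp: P2_def)
qed

end
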